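(* Assume $c < 1/2$. For any (possibly adaptive) algorithm $A$, if $A$ uses $\frac{cn}{l}$ comparisons each of set size at most $l$ (i.e. $2$-wise, $3$-wise, \dots, $l$-wise comparisons), then $A$ identifies the top-$k$ items with probability at most $7/8$. This holds even if $A$ is given the values $\{\theta_1,\dots,\theta_n\}$.
   Context: MNL model: $n$ items with positive scores $\theta_1\ge\cdots\ge\theta_k>\theta_{k+1}\ge\cdots\ge\theta_n$; the top-$k$ items are those with scores $\theta_1,\dots,\theta_k$. The algorithm sees the items only via labels given by a uniformly random permutation $\pi$ of $[n]$ (item with score $\theta_i$ has label $\pi_i$); it may know the multiset of score values but not which label carries which score. In each round it chooses (adaptively) a set $S$ with $2\le|S|\le l$ and observes one item $a\in S$ with probability $\theta_a/\sum_{j\in S}\theta_j$, independently of the past given $S$. Each round is one comparison. Success means outputting $\{\pi_1,\dots,\pi_k\}$; probability is over $\pi$, outcomes and the algorithm's randomness. *)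

theory Defs
  imports "HOL-Probability.Probability"
begin

text \<open>Items are \<open>1, \<dots>, n\<close>; item \<open>i\<close> has score \<open>\<theta> i\<close> and carries the label \<open>\<pi> i\<close>, again in
  \<open>{1..n}\<close>. An algorithm only ever handles labels.\<close>

definition mnl_choice :: "('a \<Rightarrow> real) \<Rightarrow> 'a set \<Rightarrow> 'a pmf" where
  "mnl_choice s S = embed_pmf (\<lambda>a. if a \<in> S then s a / (\<Sum>j\<in>S. s j) else 0)"

lemma pmf_mnl_choice:
  assumes "finite S" "S \<noteq> {}" "\<And>a. a \<in> S \<Longrightarrow> 0 < s a"
  shows "pmf (mnl_choice s S) a = (if a \<in> S then s a / (\<Sum>j\<in>S. s j) else 0)"
proof -
  let ?f = "\<lambda>a. if a \<in> S then s a / (\<Sum>j\<in>S. s j) else 0"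
  have pos: "0 < (\<Sum>j\<in>S. s j)"
    using assms by (intro sum_pos) auto
  have nonneg: "0 \<le> ?f x" for x
    using assms(3) pos by (simp add: less_imp_le)
  have "(\<integral>\<^sup>+x. ennreal (?f x) \<partial>count_space UNIV) = (\<Sum>x\<in>S. ennreal (?f x))"
    using assms(1) by (intro nn_integral_count_space') auto
  also have "\<dots> = ennreal (\<Sum>x\<in>S. ?f x)"
    by (intro sum_ennreal nonneg)
  also have "(\<Sum>x\<in>S. ?f x) = 1"
    using pos by (simp add: sum_divide_distrib[symmetric])
  finally show ?thesis
    unfolding mnl_choice_def by (subst pmf_embed_pmf) (use nonneg in auto)
qed

type_synonym history = "(nat set \<times> nat) list"

text \<open>Compared sets paired with the winning labels, most recent round first.\<close>

primrec transcript :: "(nat \<Rightarrow> real) \<Rightarrow> (history \<Rightarrow> nat set) \<Rightarrow> nat \<Rightarrow> history pmf" where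
  "transcript s query 0 = return_pmf []"
| "transcript s query (Suc m) =
     do { h \<leftarrow> transcript s query m;
          a \<leftarrow> mnl_choice s (query h);
          return_pmf ((query h, a) # h) }"

definition admissible_sets :: "nat \<Rightarrow> nat \<Rightarrow> nat set set" where
  "admissible_sets n l = {S. S \<subseteq> {1..n} \<and> 2 \<le> card S \<and> card S \<le> l}"

text \<open>All internal randomness of an algorithm is a seed \<open>\<omega>\<close> drawn from an arbitrary probability
  space \<open>R\<close>, which every query and the final output may use. Measurability into these count
  spaces also says that every query is an admissible set and every output a set of labels.\<close>

definition adaptive_algorithm ::
  "nat \<Rightarrow> nat \<Rightarrow> 'r measure \<Rightarrow> (history \<Rightarrow> 'r \<Rightarrow> nat set) \<Rightarrow> (history \<Rightarrow> 'r \<Rightarrow> nat set) \<Rightarrow> bool"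
where
  "adaptive_algorithm n l R query out \<longleftrightarrow>
     prob_space R \<and>
     (\<forall>h. query h \<in> R \<rightarrow>\<^sub>M count_space (admissible_sets n l)) \<and>
     (\<forall>h. out h \<in> R \<rightarrow>\<^sub>M count_space (Pow {1..n}))"

text \<open>The experiment for a fixed seed, returning whether the output is correct. The label \<open>x\<close> has
  score \<open>\<theta> (inv \<pi> x)\<close>.\<close>

definition trial ::
  "nat \<Rightarrow> nat \<Rightarrow> (nat \<Rightarrow> real) \<Rightarrow> nat \<Rightarrow> (history \<Rightarrow> nat set) \<Rightarrow> (history \<Rightarrow> nat set) \<Rightarrow> bool pmf"
where
  "trial n k \<theta> m query out =
     do { \<pi> \<leftarrow> pmf_of_set {\<pi>. \<pi> permutes {1..n}};
          h \<leftarrow> transcript (\<theta> \<circ> inv \<pi>) query m;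
          return_pmf (out h = \<pi> ` {1..k}) }"

text \<open>The seed is independent of the labelling. For an adaptive algorithm the integrand is a bounded
  measurable function of the seed: it depends on finitely many values of \<open>query\<close> and \<open>out\<close>.\<close>

definition success_prob ::
  "nat \<Rightarrow> nat \<Rightarrow> (nat \<Rightarrow> real) \<Rightarrow> nat \<Rightarrow> 'r measure \<Rightarrow>
   (history \<Rightarrow> 'r \<Rightarrow> nat set) \<Rightarrow> (history \<Rightarrow> 'r \<Rightarrow> nat set) \<Rightarrow> real"
where
  "success_prob n k \<theta> m R query out =
     (\<integral>\<omega>. pmf (trial n k \<theta> m (\<lambda>h. query h \<omega>) (\<lambda>h. out h \<omega>)) True \<partial>R)"

end

theory Submission imports Defs begin

text \<open>Since \<open>m * l < n / 2\<close>, more than half of the labels are never compared. Given the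
  history, the untouched labels are exchangeable, so with probability at least
  \<open>1 / 4\<close> the items \<open>1\<close> and \<open>n\<close> are both untouched. On that event, exchanging the two items does not
  change the likelihood of the history but changes the correct answer; hence the output is wrong with
  conditional probability at least \<open>1 / 2\<close>.\<close>

section \<open>Exchangeable weights on permutations\<close>

text \<open>Permutations of \<open>U\<close> preserve \<open>f\<close> and act transitively on
  ordered pairs of distinct elements of \<open>U\<close>. So all pairs of values for
  \<open>i\<close> and \<open>j\<close> carry the same weight, and each sum is proportional to its
  number of pairs. The cross-multiplied form also covers the case where these numbers
  vanish.\<close>

lemma sum_permutes_exchangeable:
  fixes f :: "('a \<Rightarrow> 'a) \<Rightarrow> real"
  assumes fin: "finite N" and UN: "U \<subseteq> N" and VU: "V \<subseteq> U" and ij: "i \<noteq> j"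
    and inv: "\<And>\<sigma> \<pi>. \<sigma> permutes U \<Longrightarrow> \<pi> permutes N \<Longrightarrow> f (\<sigma> \<circ> \<pi>) = f \<pi>"
  shows "(\<Sum>\<pi> | \<pi> permutes N \<and> \<pi> i \<in> V \<and> \<pi> j \<in> V. f \<pi>) * (real (card U) * (real (card U) - 1)) =
    (\<Sum>\<pi> | \<pi> permutes N \<and> \<pi> i \<in> U \<and> \<pi> j \<in> U. f \<pi>) * (real (card V) * (real (card V) - 1))"
proof -
  define W where "W a b = (\<Sum>\<pi> | \<pi> permutes N \<and> \<pi> i = a \<and> \<pi> j = b. f \<pi>)" for a b
  have W_eq: "W a b = W a' b'"
    if "a \<in> U" "b \<in> U" "a \<noteq> b" "a' \<in> U" "b' \<in> U" "a' \<noteq> b'" for a b a' b'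
  proof -
    \<comment> \<open>\<open>\<tau>\<close> brings \<open>a\<close> to \<open>a'\<close>; the second
      transposition then brings \<open>\<tau> b\<close> to \<open>b'\<close> and leaves
      \<open>a'\<close> in place, as \<open>a'\<close> differs from both points it moves.\<close>
    define \<tau> where "\<tau> = Transposition.transpose a a'"
    define \<sigma> where "\<sigma> = Transposition.transpose (\<tau> b) b' \<circ> \<tau>"
    have \<tau>: "\<tau> permutes U"
      unfolding \<tau>_def using that by (intro permutes_swap_id)
    have \<sigma>: "\<sigma> permutes U"
      unfolding \<sigma>_def using that \<tau> by (intro permutes_compose permutes_swap_id) (auto simp: permutes_in_image)
    have \<sigma>N: "\<sigma> permutes N"
      using \<sigma> UN by (rule permutes_subset)
    have "\<tau> b \<noteq> a'"
      using that by (auto simp: \<tau>_def Transposition.transpose_def)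
    then have \<sigma>a: "\<sigma> a = a'" and \<sigma>b: "\<sigma> b = b'"
      using that by (auto simp: \<sigma>_def \<tau>_def Transposition.transpose_def)
    have inv_\<sigma>: "inv \<sigma> a' = a" "inv \<sigma> b' = b"
      using \<sigma>a \<sigma>b permutes_inverses(2)[OF \<sigma>] by metis+
    show ?thesis
      unfolding W_def
    proof (rule sum.reindex_bij_witness[where i = "\<lambda>\<pi>. inv \<sigma> \<circ> \<pi>" and j = "\<lambda>\<pi>. \<sigma> \<circ> \<pi>"])
      fix \<pi> assume \<pi>: "\<pi> \<in> {\<pi>. \<pi> permutes N \<and> \<pi> i = a \<and> \<pi> j = b}"
      show "inv \<sigma> \<circ> (\<sigma> \<circ> \<pi>) = \<pi>"
        by (simp add: o_assoc permutes_inv_o[OF \<sigma>])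
      show "\<sigma> \<circ> \<pi> \<in> {\<pi>. \<pi> permutes N \<and> \<pi> i = a' \<and> \<pi> j = b'}"
        using \<pi> \<sigma>a \<sigma>b \<sigma>N by (auto intro: permutes_compose)
      show "f (\<sigma> \<circ> \<pi>) = f \<pi>"
        using \<pi> by (intro inv \<sigma>) auto
    next
      fix \<pi> assume \<pi>: "\<pi> \<in> {\<pi>. \<pi> permutes N \<and> \<pi> i = a' \<and> \<pi> j = b'}"
      show "\<sigma> \<circ> (inv \<sigma> \<circ> \<pi>) = \<pi>"
        by (simp add: o_assoc permutes_inv_o[OF \<sigma>])
      show "inv \<sigma> \<circ> \<pi> \<in> {\<pi>. \<pi> permutes N \<and> \<pi> i = a \<and> \<pi> j = b}"
        using \<pi> inv_\<sigma> permutes_inv[OF \<sigma>N] by (auto intro: permutes_compose)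
    qed
  qed
  have finU: "finite U" using UN fin by (rule finite_subset)
  have finV: "finite V" using VU finU by (rule finite_subset)
  \<comment> \<open>Permutations are grouped by the pair \<open>(\<pi> i, \<pi> j)\<close>;
    injectivity and \<open>i \<noteq> j\<close> rule out the diagonal.\<close>
  have split: "(\<Sum>\<pi> | \<pi> permutes N \<and> \<pi> i \<in> X \<and> \<pi> j \<in> X. f \<pi>) =
      (\<Sum>(a, b) | a \<in> X \<and> b \<in> X \<and> a \<noteq> b. W a b)" if "finite X" for X
  proof -
    let ?S = "{\<pi>. \<pi> permutes N \<and> \<pi> i \<in> X \<and> \<pi> j \<in> X}"
    let ?T = "{(a, b). a \<in> X \<and> b \<in> X \<and> a \<noteq> b}"
    have "finite ?S"
      using finite_permutations[OF fin] by (rule rev_finite_subset) auto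
    moreover have "finite ?T"
      by (rule finite_subset[of _ "X \<times> X"]) (use that in auto)
    moreover have "(\<lambda>\<pi>. (\<pi> i, \<pi> j)) ` ?S \<subseteq> ?T"
      using ij by (auto dest: permutes_inj injD)
    ultimately have "(\<Sum>y\<in>?T. \<Sum>\<pi>\<in>{\<pi> \<in> ?S. (\<pi> i, \<pi> j) = y}. f \<pi>) = (\<Sum>\<pi>\<in>?S. f \<pi>)"
      by (rule sum.group)
    also have "(\<Sum>y\<in>?T. \<Sum>\<pi>\<in>{\<pi> \<in> ?S. (\<pi> i, \<pi> j) = y}. f \<pi>) = (\<Sum>(a, b)\<in>?T. W a b)"
      unfolding W_def by (intro sum.cong) (auto intro!: sum.cong)
    finally show ?thesis by simp
  qed
  have card_pairs: "real (card {(a, b). a \<in> X \<and> b \<in> X \<and> a \<noteq> b}) = real (card X) * (real (card X) - 1)"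
    if "finite X" for X :: "'a set"
  proof -
    have "{(a, b). a \<in> X \<and> b \<in> X \<and> a \<noteq> b} = (SIGMA a:X. X - {a})"
      by auto
    also have "card \<dots> = (\<Sum>a\<in>X. card X - 1)"
      using that by (subst card_SigmaI) auto
    finally show ?thesis
      by (cases "card X") (auto simp: algebra_simps)
  qed
  show ?thesis
  proof (cases "\<exists>a b. a \<in> U \<and> b \<in> U \<and> a \<noteq> b")
    case True
    then obtain a0 b0 where ab: "a0 \<in> U" "b0 \<in> U" "a0 \<noteq> b0" by blast
    have "(\<Sum>\<pi> | \<pi> permutes N \<and> \<pi> i \<in> X \<and> \<pi> j \<in> X. f \<pi>) =
        real (card X) * (real (card X) - 1) * W a0 b0" if "X \<subseteq> U" for X
    proof -
      have finX: "finite X" using that finU by (rule finite_subset)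
      have "(\<Sum>(a, b) | a \<in> X \<and> b \<in> X \<and> a \<noteq> b. W a b) =
          (\<Sum>(a, b) | a \<in> X \<and> b \<in> X \<and> a \<noteq> b. W a0 b0)"
      proof (intro sum.cong refl, clarify)
        fix a b assume "a \<in> X" "b \<in> X" "a \<noteq> b"
        then show "W a b = W a0 b0"
          using that ab by (intro W_eq) auto
      qed
      then show ?thesis
        using split[OF finX] card_pairs[OF finX] by (simp add: case_prod_unfold)
    qed
    from this[OF VU] this[OF subset_refl] show ?thesis by simp
  next
    case False
    then have "{(a, b). a \<in> U \<and> b \<in> U \<and> a \<noteq> b} = {}" "{(a, b). a \<in> V \<and> b \<in> V \<and> a \<noteq> b} = {}"
      using VU by auto
    with split[OF finU] split[OF finV] show ?thesis by simp
  qed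
qed

section \<open>Likelihood of a history\<close>

definition touched :: "history \<Rightarrow> nat set" where
  "touched h = \<Union> (fst ` set h)"

lemma touched_simps [simp]:
  "touched [] = {}" "touched ((S, a) # h) = S \<union> touched h"
  by (auto simp: touched_def)

lemma mnl_choice_cong:
  "(\<And>x. x \<in> S \<Longrightarrow> s x = s' x) \<Longrightarrow> mnl_choice s S = mnl_choice s' S"
  unfolding mnl_choice_def by (intro arg_cong[where f = embed_pmf] ext) (simp cong: sum.cong)

lemma transcript_Suc_map:
  "transcript s q (Suc m) =
     transcript s q m \<bind> (\<lambda>h. map_pmf (\<lambda>a. (q h, a) # h) (mnl_choice s (q h)))"
  by (simp add: map_pmf_def)

text \<open>Since a history records each query along with its winner, only one predecessor
  contributes to the bind, and only if the recorded set is the one the algorithm asks there.\<close>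

lemma pmf_transcript_Suc:
  "pmf (transcript s q (Suc m)) ((S, a) # h) =
     (if S = q h then pmf (transcript s q m) h * pmf (mnl_choice s S) a else 0)"
proof -
  have "pmf (map_pmf (\<lambda>a. (q h', a) # h') (mnl_choice s (q h'))) ((S, a) # h) =
      indicator {h} h' * (if S = q h then pmf (mnl_choice s S) a else 0)" for h'
  proof (cases "h' = h \<and> S = q h")
    case True
    have "inj (\<lambda>a. (q h, a) # h)" by (auto intro: injI)
    with True show ?thesis
      using pmf_map_inj'[of "\<lambda>a. (q h, a) # h" "mnl_choice s (q h)" a] by simp
  next
    case False
    then show ?thesis
      by (subst pmf_map_outside) auto
  qed
  then show ?thesis
    unfolding transcript_Suc_map pmf_bind by (simp add: pmf.rep_eq)
qed

lemma pmf_transcript_Suc_Nil: "pmf (transcript s q (Suc m)) [] = 0"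
  by (auto simp: pmf_eq_0_set_pmf)

text \<open>The likelihood is a product of choice probabilities, each depending only on scores
  within a compared set, or zero for a reason (wrong length or wrong query) in which the scores do
  not enter.\<close>

lemma pmf_transcript_cong:
  "(\<And>x. x \<in> touched h \<Longrightarrow> s x = s' x) \<Longrightarrow> pmf (transcript s q m) h = pmf (transcript s' q m) h"
proof (induction m arbitrary: h)
  case (Suc m)
  show ?case
  proof (cases h)
    case Nil
    then show ?thesis by (simp only: pmf_transcript_Suc_Nil)
  next
    case (Cons p h')
    obtain S a where p: "p = (S, a)" by (cases p)
    have "pmf (transcript s q m) h' = pmf (transcript s' q m) h'"
      using Suc.prems Cons p by (intro Suc.IH) simp
    moreover have "mnl_choice s S = mnl_choice s' S"
      using Suc.prems Cons p by (intro mnl_choice_cong) simp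
    ultimately show ?thesis
      unfolding Cons p pmf_transcript_Suc by (simp only:)
  qed
qed simp

text \<open>The winner adds no touched label beyond the query, so the current history already
  determines what is touched after the next round. The martingale step can therefore ignore the
  outcome of that round.\<close>

lemma map_touched_transcript_Suc:
  "map_pmf touched (transcript s q (Suc m)) = map_pmf (\<lambda>h. q h \<union> touched h) (transcript s q m)"
  by (simp add: map_bind_pmf map_pmf_def[of "\<lambda>h. q h \<union> touched h"])

section \<open>Runs at a fixed seed\<close>

locale deterministic_algorithm =
  fixes n l :: nat and \<theta> :: "nat \<Rightarrow> real" and q :: "history \<Rightarrow> nat set"
  assumes score_pos: "i \<in> {1..n} \<Longrightarrow> 0 < \<theta> i"
    and query_admissible: "q h \<in> admissible_sets n l"
begin

abbreviation run :: "(nat \<Rightarrow> nat) \<Rightarrow> nat \<Rightarrow> history pmf" where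
  "run \<pi> m \<equiv> transcript (\<theta> \<circ> inv \<pi>) q m"

text \<open>One finite set supports the runs under all labellings, so expectations become finite
  sums that can be swapped with sums over labellings.\<close>

definition histories :: "nat \<Rightarrow> history set" where
  "histories m = {h. set h \<subseteq> admissible_sets n l \<times> {1..n} \<and> length h = m}"

definition untouched :: "history \<Rightarrow> nat set" where
  "untouched h = {1..n} - touched h"

lemma finite_histories: "finite (histories m)"
proof -
  have "finite (admissible_sets n l)"
    by (rule finite_subset[of _ "Pow {1..n}"]) (auto simp: admissible_sets_def)
  then show ?thesis
    unfolding histories_def by (intro finite_lists_length_eq finite_cartesian_product) auto
qed

lemma query_props: "finite (q h)" "q h \<noteq> {}" "q h \<subseteq> {1..n}" "card (q h) \<le> l"
  using query_admissible[of h] finite_subset[of "q h" "{1..n}"] by (auto simp: admissible_sets_def)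

lemma set_run:
  assumes \<pi>: "\<pi> permutes {1..n}"
  shows "set_pmf (run \<pi> m) \<subseteq> histories m"
proof (induction m)
  case (Suc m)
  have winner: "set_pmf (mnl_choice (\<theta> \<circ> inv \<pi>) (q h)) \<subseteq> {1..n}" for h
  proof
    fix a assume a: "a \<in> set_pmf (mnl_choice (\<theta> \<circ> inv \<pi>) (q h))"
    have pos: "0 < (\<theta> \<circ> inv \<pi>) x" if "x \<in> q h" for x
      using that query_props(3)[of h] permutes_in_image[OF permutes_inv[OF \<pi>], of x]
      by (auto intro!: score_pos)
    have "a \<in> q h"
      using a pmf_mnl_choice[where s = "\<theta> \<circ> inv \<pi>" and a = a, OF query_props(1,2) pos]
      by (auto simp: set_pmf_iff simp del: o_apply split: if_splits)
    then show "a \<in> {1..n}" using query_props(3) by blast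
  qed
  show ?case
  proof
    fix h' assume "h' \<in> set_pmf (run \<pi> (Suc m))"
    then obtain h a where "h \<in> set_pmf (run \<pi> m)"
      and "a \<in> set_pmf (mnl_choice (\<theta> \<circ> inv \<pi>) (q h))" and "h' = (q h, a) # h"
      by auto
    moreover from this have "h \<in> histories m" "a \<in> {1..n}"
      using Suc winner by blast+
    ultimately show "h' \<in> histories (Suc m)"
      using query_admissible[of h] by (simp add: histories_def)
  qed
qed (simp add: histories_def)

lemma expectation_run:
  assumes "\<pi> permutes {1..n}"
  shows "measure_pmf.expectation (run \<pi> m) f = (\<Sum>h\<in>histories m. pmf (run \<pi> m) h * f h)"
  using set_run[OF assms, of m] by (subst integral_measure_pmf[OF finite_histories]) auto

lemma card_touched_le: "h \<in> histories m \<Longrightarrow> card (touched h) \<le> m * l"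
proof (induction m arbitrary: h)
  case (Suc m)
  then obtain S a h' where h: "h = (S, a) # h'" "h' \<in> histories m" "S \<in> admissible_sets n l"
    by (cases h) (auto simp: histories_def)
  have "card (S \<union> touched h') \<le> card S + card (touched h')" by (rule card_Un_le)
  also have "\<dots> \<le> l + m * l"
    using Suc.IH[OF h(2)] h(3) by (intro add_mono) (auto simp: admissible_sets_def)
  finally show ?case using h by simp
qed (simp add: histories_def)

lemma card_untouched_ge:
  assumes "h \<in> histories m"
  shows "n - m * l \<le> card (untouched h)"
proof -
  have "touched h \<subseteq> {1..n}"
    using assms by (fastforce simp: histories_def touched_def admissible_sets_def)
  then have "finite (touched h)"
    by (rule finite_subset) simp
  from diff_card_le_card_Diff[OF this, of "{1..n}"] card_touched_le[OF assms] show ?thesis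
    unfolding untouched_def by simp
qed

text \<open>\<open>inv \<sigma>\<close> fixes every touched label, so both labellings give the same
  scores to all labels that \<open>h\<close> involves. This is the exchangeability of the untouched
  labels given \<open>h\<close>.\<close>

lemma run_relabel_untouched:
  assumes "\<sigma> permutes untouched h" and "\<pi> permutes {1..n}"
  shows "pmf (run (\<sigma> \<circ> \<pi>) m) h = pmf (run \<pi> m) h"
proof (rule pmf_transcript_cong)
  fix x assume "x \<in> touched h"
  then have "inv \<sigma> x = x"
    using permutes_not_in[OF permutes_inv[OF assms(1)], of x] by (simp add: untouched_def)
  then show "(\<theta> \<circ> inv (\<sigma> \<circ> \<pi>)) x = (\<theta> \<circ> inv \<pi>) x"
    using assms by (simp add: o_inv_distrib permutes_bij)
qed

section \<open>Mass of labellings with two untouched items\<close>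

text \<open>This is \<open>fact n\<close> times the joint probability that the history is
  \<open>h\<close> and items \<open>i\<close> and \<open>j\<close> have labels in \<open>V\<close>.
  Joint masses avoid conditioning on histories of probability zero.\<close>

definition unseen_mass :: "nat \<Rightarrow> nat \<Rightarrow> nat \<Rightarrow> history \<Rightarrow> nat set \<Rightarrow> real" where
  "unseen_mass i j m h V = (\<Sum>\<pi> | \<pi> permutes {1..n} \<and> \<pi> i \<in> V \<and> \<pi> j \<in> V. pmf (run \<pi> m) h)"

text \<open>The normalised indicator that items \<open>i\<close> and \<open>j\<close> are untouched is a martingale, so its mean is
  that of the empty history.\<close>

lemma sum_unseen_mass:
  assumes ij: "i \<in> {1..n}" "j \<in> {1..n}" "i \<noteq> j" and "m * l + 2 \<le> n"
  shows "(\<Sum>h\<in>histories m. unseen_mass i j m h (untouched h) /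
      (real (card (untouched h)) * (real (card (untouched h)) - 1))) = fact n / (real n * (real n - 1))"
  using \<open>m * l + 2 \<le> n\<close>
proof (induction m)
  case 0
  have "{\<pi>. \<pi> permutes {1..n} \<and> \<pi> i \<in> {1..n} \<and> \<pi> j \<in> {1..n}} = {\<pi>. \<pi> permutes {1..n}}"
    using ij by (auto simp: permutes_in_image simp del: atLeastAtMost_iff)
  then show ?case
    by (simp add: histories_def untouched_def unseen_mass_def card_permutations cong: conj_cong)
next
  case (Suc m)
  let ?P = "{\<pi>. \<pi> permutes {1..n}}"
  \<comment> \<open>If both items lie among \<open>u\<close> untouched labels and the next query
    leaves \<open>v\<close> of these, both stay untouched with probability
    \<open>v * (v - 1) / (u * (u - 1))\<close>. The normalisation \<open>g\<close> compensates
    exactly for this factor.\<close>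
  define g where "g X = 1 / (real (card X) * (real (card X) - 1))" for X :: "nat set"
  \<comment> \<open>\<open>F\<close> sees the history only through its touched set \<open>T\<close>,
    so its expectation can be taken under the law of \<open>touched\<close>.\<close>
  define F where "F \<pi> T = (if \<pi> i \<in> {1..n} - T \<and> \<pi> j \<in> {1..n} - T then g ({1..n} - T) else 0)"
    for \<pi> and T :: "nat set"
  have finP: "finite ?P" by (simp add: finite_permutations)
  \<comment> \<open>Swapping the sums passes between histories and labellings. It is used in both
    directions: forward after \<open>Suc m\<close> rounds, and back after \<open>m\<close> rounds
    with the next query removed.\<close>
  have mean: "(\<Sum>h\<in>histories m'. unseen_mass i j m' h (V h) * g (V h)) =
      (\<Sum>\<pi>\<in>?P. measure_pmf.expectation (run \<pi> m')
        (\<lambda>h. if \<pi> i \<in> V h \<and> \<pi> j \<in> V h then g (V h) else 0))" for V m'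
  proof -
    have "(\<Sum>\<pi>\<in>?P. measure_pmf.expectation (run \<pi> m')
          (\<lambda>h. if \<pi> i \<in> V h \<and> \<pi> j \<in> V h then g (V h) else 0)) =
        (\<Sum>\<pi>\<in>?P. \<Sum>h\<in>histories m'.
          pmf (run \<pi> m') h * (if \<pi> i \<in> V h \<and> \<pi> j \<in> V h then g (V h) else 0))"
      by (intro sum.cong refl expectation_run) auto
    also have "\<dots> = (\<Sum>h\<in>histories m'. \<Sum>\<pi>\<in>?P.
          if \<pi> i \<in> V h \<and> \<pi> j \<in> V h then pmf (run \<pi> m') h * g (V h) else 0)"
      by (subst sum.swap) (intro sum.cong refl, auto)
    also have "\<dots> = (\<Sum>h\<in>histories m'. unseen_mass i j m' h (V h) * g (V h))"
      unfolding unseen_mass_def sum_distrib_right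
      by (rule sum.cong[OF refl], subst sum.inter_filter[OF finP, symmetric], simp)
    finally show ?thesis by simp
  qed
  have untouched_Diff: "untouched h - q h = {1..n} - (q h \<union> touched h)" for h
    by (auto simp: untouched_def)
  have "(\<Sum>h\<in>histories (Suc m). unseen_mass i j (Suc m) h (untouched h) * g (untouched h)) =
      (\<Sum>\<pi>\<in>?P. measure_pmf.expectation (map_pmf touched (run \<pi> (Suc m))) (F \<pi>))"
    unfolding mean integral_map_pmf F_def untouched_def ..
  also have "\<dots> = (\<Sum>h\<in>histories m. unseen_mass i j m h (untouched h - q h) * g (untouched h - q h))"
    unfolding mean map_touched_transcript_Suc integral_map_pmf F_def untouched_Diff ..
  also have "\<dots> = (\<Sum>h\<in>histories m. unseen_mass i j m h (untouched h) * g (untouched h))"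
  proof (intro sum.cong refl)
    fix h assume h: "h \<in> histories m"
    let ?U = "untouched h" and ?V = "untouched h - q h"
    have "card ?U - card (q h) \<le> card ?V"
      by (rule diff_card_le_card_Diff) (rule query_props)
    \<comment> \<open>The bound on \<open>Suc m * l\<close> leaves room for one more query and two
      further labels, so neither normaliser is zero.\<close>
    with card_untouched_ge[OF h] query_props(4)[of h] Suc.prems
    have card_V: "2 \<le> card ?V" by simp
    have "card ?V \<le> card ?U"
      by (intro card_mono) (auto simp: untouched_def)
    with card_V have nz: "real (card X) * (real (card X) - 1) \<noteq> 0" if "X \<in> {?U, ?V}" for X
      using that by auto
    \<comment> \<open>With \<open>h\<close> fixed, the next query and hence \<open>?V\<close> are
      fixed too, so exchangeability applies to \<open>?V\<close> inside \<open>?U\<close>.\<close>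
    have "unseen_mass i j m h ?V * (real (card ?U) * (real (card ?U) - 1)) =
        unseen_mass i j m h ?U * (real (card ?V) * (real (card ?V) - 1))"
      unfolding unseen_mass_def using ij
      by (intro sum_permutes_exchangeable run_relabel_untouched) (auto simp: untouched_def)
    with frac_eq_eq[OF nz[of ?V] nz[of ?U]] show "unseen_mass i j m h ?V * g ?V = unseen_mass i j m h ?U * g ?U"
      unfolding g_def by simp
  qed
  finally show ?case
    using Suc by (simp add: g_def)
qed

section \<open>Success and error at a fixed seed\<close>

text \<open>The factor \<open>fact n\<close> clears the uniform weight of the labellings. Summing
  over histories on the outside lets each one be treated with a single fixed output
  \<open>out h\<close>.\<close>

lemma trial_True:
  "fact n * pmf (trial n k \<theta> m q out) True =
     (\<Sum>h\<in>histories m. \<Sum>\<pi> | \<pi> permutes {1..n}. if out h = \<pi> ` {1..k} then pmf (run \<pi> m) h else 0)"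
proof -
  let ?P = "{\<pi>. \<pi> permutes {1..n}}"
  have P: "finite ?P" "?P \<noteq> {}" "card ?P = fact n"
    using permutes_id[of "{1..n}"] card_permutations[of "{1..n}" n] finite_permutations[of "{1..n}"]
    by (blast, blast, simp)
  have "pmf (trial n k \<theta> m q out) True = (\<Sum>\<pi>\<in>?P. \<Sum>h\<in>histories m.
      pmf (run \<pi> m) h * pmf (return_pmf (out h = \<pi> ` {1..k})) True) / fact n"
    unfolding trial_def pmf_bind integral_pmf_of_set[OF P(2,1)] P(3)
    by (simp add: expectation_run)
  then show ?thesis
    by (subst sum.swap) (auto intro!: sum.cong simp: indicator_def)
qed

lemma sum_pmf_run:
  "(\<Sum>h\<in>histories m. \<Sum>\<pi> | \<pi> permutes {1..n}. pmf (run \<pi> m) h) = fact n"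
proof -
  have "(\<Sum>h\<in>histories m. pmf (run \<pi> m) h) = 1" if "\<pi> permutes {1..n}" for \<pi>
    using expectation_run[OF that, of m "\<lambda>_. 1"] by simp
  then show ?thesis
    by (subst sum.swap) (simp add: card_permutations)
qed

text \<open>Pair each labelling that hides items \<open>1\<close> and \<open>n\<close> with the one
  exchanging them. The two explain \<open>h\<close> equally well but have different top sets, so any
  guess \<open>A\<close> errs on at least one of them, hence on at least half of the unseen
  mass.\<close>

lemma unseen_mass_le_errors:
  assumes "1 \<le> k" "k < n"
  shows "unseen_mass 1 n m h (untouched h) \<le>
    2 * (\<Sum>\<pi> | \<pi> permutes {1..n}. if A = \<pi> ` {1..k} then 0 else pmf (run \<pi> m) h)"
proof -
  let ?P = "{\<pi>. \<pi> permutes {1..n}}"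
  let ?Q = "{\<pi>. \<pi> permutes {1..n} \<and> \<pi> 1 \<in> untouched h \<and> \<pi> n \<in> untouched h}"
  let ?t = "Transposition.transpose 1 n :: nat \<Rightarrow> nat"
  define e where "e \<pi> = (if A = \<pi> ` {1..k} then 0 else pmf (run \<pi> m) h)" for \<pi>
  have t: "?t permutes {1..n}"
    using assms by (intro permutes_swap_id) auto
  have fin: "finite ?P" by (simp add: finite_permutations)
  have comp: "\<pi> \<circ> ?t \<in> ?Q" if "\<pi> \<in> ?Q" for \<pi>
    using that t by (auto intro: permutes_compose)
  have flip: "(\<Sum>\<pi>\<in>?Q. e \<pi>) = (\<Sum>\<pi>\<in>?Q. e (\<pi> \<circ> ?t))"
    using comp
    by (intro sum.reindex_bij_witness[where i = "\<lambda>\<pi>. \<pi> \<circ> ?t" and j = "\<lambda>\<pi>. \<pi> \<circ> ?t"])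
      (auto simp: o_assoc[symmetric])
  have "pmf (run \<pi> m) h \<le> e \<pi> + e (\<pi> \<circ> ?t)" if \<pi>: "\<pi> \<in> ?Q" for \<pi>
  proof -
    have inj: "inj \<pi>" using \<pi> permutes_inj by blast
    \<comment> \<open>Swapping the two items amounts to swapping their labels, which are untouched,
      so the likelihood of \<open>h\<close> does not change.\<close>
    have "\<pi> \<circ> ?t = Transposition.transpose (\<pi> 1) (\<pi> n) \<circ> \<pi>"
      using inj by (auto simp: fun_eq_iff Transposition.transpose_def inj_eq)
    moreover have "Transposition.transpose (\<pi> 1) (\<pi> n) permutes untouched h"
      using \<pi> by (intro permutes_swap_id) auto
    ultimately have same: "pmf (run (\<pi> \<circ> ?t) m) h = pmf (run \<pi> m) h"
      using \<pi> run_relabel_untouched by simp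
    \<comment> \<open>The label \<open>\<pi> 1\<close> separates the two answers: after the swap it
      belongs to item \<open>n\<close>, which lies outside the top \<open>k\<close>.\<close>
    have "\<pi> 1 \<in> \<pi> ` {1..k}" using assms by simp
    moreover have "\<pi> 1 \<notin> (\<pi> \<circ> ?t) ` {1..k}"
      using inj assms by (auto simp: Transposition.transpose_def inj_eq split: if_splits)
    ultimately have "\<pi> ` {1..k} \<noteq> (\<pi> \<circ> ?t) ` {1..k}" by metis
    then show ?thesis
      unfolding e_def same by auto
  qed
  then have "unseen_mass 1 n m h (untouched h) \<le> (\<Sum>\<pi>\<in>?Q. e \<pi> + e (\<pi> \<circ> ?t))"
    unfolding unseen_mass_def by (intro sum_mono)
  also have "\<dots> = 2 * (\<Sum>\<pi>\<in>?Q. e \<pi>)"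
    by (simp only: sum.distrib flip[symmetric])
  also have "(\<Sum>\<pi>\<in>?Q. e \<pi>) \<le> (\<Sum>\<pi>\<in>?P. e \<pi>)"
    using fin by (intro sum_mono2) (auto simp: e_def)
  finally show ?thesis
    unfolding e_def by simp
qed

text \<open>The probability that items \<open>1\<close> and \<open>n\<close> both stay untouched is
  at least \<open>1 / 4\<close> and at most twice the error probability, so the latter is at least
  \<open>1 / 8\<close>.\<close>

lemma trial_success_le:
  assumes k: "1 \<le> k" "k < n" and ml: "2 * (m * l) < n"
  shows "pmf (trial n k \<theta> m q out) True \<le> 7 / 8"
proof -
  define p where "p = pmf (trial n k \<theta> m q out) True"
  \<comment> \<open>\<open>d\<close> is the worst-case number of untouched labels, as a real number;
    \<open>D h\<close> is the actual one.\<close>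
  define d where "d = real n - real (m * l)"
  define D where "D h = real (card (untouched h))" for h
  let ?E = "\<lambda>h. \<Sum>\<pi> | \<pi> permutes {1..n}. if out h = \<pi> ` {1..k} then 0 else pmf (run \<pi> m) h"
  have "fact n * (1 - p) = (\<Sum>h\<in>histories m. ?E h)"
    unfolding p_def right_diff_distrib trial_True mult_1_right
    unfolding sum_pmf_run[of m, symmetric] sum_subtractf[symmetric]
    by (intro sum.cong refl) auto
  moreover have "(\<Sum>h\<in>histories m. unseen_mass 1 n m h (untouched h)) \<le> 2 * (\<Sum>h\<in>histories m. ?E h)"
    by (subst sum_distrib_left) (intro sum_mono unseen_mass_le_errors k)
  ultimately have err: "(\<Sum>h\<in>histories m. unseen_mass 1 n m h (untouched h)) \<le> 2 * (fact n * (1 - p))"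
    by simp
  \<comment> \<open>Integrality sharpens the strict bound to \<open>n + 1 \<le> 2 * d\<close>, hence
    \<open>n - 1 \<le> 2 * (d - 1)\<close>. From \<open>n \<le> 2 * d\<close> alone the quotient
    below could fall just short of \<open>1 / 4\<close>.\<close>
  have "2 * (m * l) + 1 \<le> n" "m * l + 2 \<le> n"
    using ml k by linarith+
  then have "real (2 * (m * l) + 1) \<le> real n" "real (m * l + 2) \<le> real n"
    by (simp_all only: of_nat_le_iff)
  then have d: "real n + 1 \<le> 2 * d" "2 \<le> d"
    by (simp_all add: d_def)
  have "fact n / (real n * (real n - 1)) * (d * (d - 1)) =
      (\<Sum>h\<in>histories m. unseen_mass 1 n m h (untouched h) / (D h * (D h - 1)) * (d * (d - 1)))"
    unfolding D_def sum_distrib_right[symmetric] using k ml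
    by (subst sum_unseen_mass) auto
  \<comment> \<open>Each history leaves at least \<open>d\<close> labels untouched, so every factor
    \<open>d * (d - 1) / (D h * (D h - 1))\<close> is at most \<open>1\<close>.\<close>
  also have "\<dots> \<le> (\<Sum>h\<in>histories m. unseen_mass 1 n m h (untouched h))"
  proof (intro sum_mono)
    fix h assume h: "h \<in> histories m"
    have "d \<le> D h"
      using card_untouched_ge[OF h] ml unfolding d_def D_def by linarith
    then have "d * (d - 1) \<le> D h * (D h - 1)" "0 < D h * (D h - 1)"
      using d by (auto intro!: mult_mono)
    moreover have "0 \<le> unseen_mass 1 n m h (untouched h)"
      unfolding unseen_mass_def by (intro sum_nonneg) auto
    ultimately show "unseen_mass 1 n m h (untouched h) / (D h * (D h - 1)) * (d * (d - 1)) \<le>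
        unseen_mass 1 n m h (untouched h)"
      by (simp add: divide_le_eq mult_left_mono)
  qed
  also note err
  finally have "fact n * (d * (d - 1) / (real n * (real n - 1))) \<le> fact n * (2 * (1 - p))"
    by (simp only: times_divide_eq_left times_divide_eq_right mult.left_commute[of 2])
  then have "d * (d - 1) / (real n * (real n - 1)) \<le> 2 * (1 - p)"
    by (simp only: mult_le_cancel_left_pos fact_gt_zero)
  moreover have "1 / 4 \<le> d * (d - 1) / (real n * (real n - 1))"
  proof -
    have "real n * (real n - 1) \<le> (2 * d) * (2 * (d - 1))"
      using d k by (intro mult_mono) auto
    moreover have "0 < real n * (real n - 1)"
      using k by simp
    ultimately show ?thesis
      by (simp add: pos_le_divide_eq algebra_simps)
  qed
  ultimately have "1 / 4 \<le> 2 * (1 - p)"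
    by (rule order_trans[rotated])
  then show ?thesis
    unfolding p_def by simp
qed

end

section \<open>Averaging over the seed\<close>

theorem theorem8:
  fixes n k l m :: nat and \<theta> :: "nat \<Rightarrow> real" and c :: real
    and R :: "'r measure" and query out :: "history \<Rightarrow> 'r \<Rightarrow> nat set"
  assumes "1 \<le> k" and "k < n"
    and "\<And>i. i \<in> {1..n} \<Longrightarrow> 0 < \<theta> i"
    and "antimono_on {1..n} \<theta>"
    and "\<theta> (k + 1) < \<theta> k"
    and "2 \<le> l"
    and "c < 1 / 2"
    and "adaptive_algorithm n l R query out"
    and "real m \<le> c * real n / real l"
  shows "success_prob n k \<theta> m R query out \<le> 7 / 8"
proof -
  interpret prob_space R
    using assms(8) by (simp add: adaptive_algorithm_def)
  have "real m * real l \<le> c * real n"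
    using assms(6,9) by (simp add: pos_le_divide_eq)
  also have "\<dots> < 1 / 2 * real n"
    using assms(2,7) by (intro mult_strict_right_mono) auto
  finally have "real (2 * (m * l)) < real n" by simp
  then have ml: "2 * (m * l) < n" by (simp only: of_nat_less_iff)
  have le: "pmf (trial n k \<theta> m (\<lambda>h. query h \<omega>) (\<lambda>h. out h \<omega>)) True \<le> 7 / 8"
    if "\<omega> \<in> space R" for \<omega>
  proof -
    \<comment> \<open>A measurable map into a count space takes its values in the carrier, so every
      seed, not just almost every one, yields admissible queries.\<close>
    have "query h \<omega> \<in> admissible_sets n l" for h
    proof -
      have "query h \<in> R \<rightarrow>\<^sub>M count_space (admissible_sets n l)"
        using assms(8) unfolding adaptive_algorithm_def by blast
      from measurable_space[OF this that] show ?thesis by simp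
    qed
    then interpret deterministic_algorithm n l \<theta> "\<lambda>h. query h \<omega>"
      using assms(3) by unfold_locales
    show ?thesis
      using assms(1,2) ml by (rule trial_success_le)
  qed
  \<comment> \<open>An integrable integrand inherits the pointwise bound because \<open>R\<close>
    has total mass \<open>1\<close>; otherwise the Bochner integral is \<open>0\<close> by
    convention, which also satisfies the bound.\<close>
  show ?thesis
  proof (cases "integrable R (\<lambda>\<omega>. pmf (trial n k \<theta> m (\<lambda>h. query h \<omega>) (\<lambda>h. out h \<omega>)) True)")
    case True
    then show ?thesis
      unfolding success_prob_def using le by (intro integral_le_const) auto
  qed (simp add: success_prob_def not_integrable_integral_eq)
qed

end
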